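(* The counting number of a $\mathbb{Z}$-polyfract $\mathcal{P}$ is determined by the number of taking discrete difference operators of its associated function. Precisely: let a triple $(\mathcal{P},\mathcal{A},\mathcal{N})$ be a $\mathbb{Z}$-polyfract, i.e. given by some finite $\mathcal{A}\subset\mathbb{Z}$ and some finite $\mathcal{N}\subset\mathbb{N}^N$, and let $f(\mathcal{P}):\mathbb{Z}^N\to\mathbb{Z}$ be its associated function. Then $$\mathrm{count}(\mathcal{P})=\mathrm{fdeg}(f(\mathcal{P})).$$
   Context: $\mathbb{N}=\{0,1,2,\dots\}$ and $N\ge 1$. For $\underline{n}=(n_1,\dots,n_N)\in\mathbb{N}^N$, $|\underline{n}|=n_1+\cdots+n_N$. For $x\in\mathbb{Z}$ and $k\in\mathbb{N}$, $\binom{x}{k}=x(x-1)\cdots(x-k+1)/k!$ (with $\binom{x}{0}=1$). A $\mathbb{Z}$-polyfract $(\mathcal{P},\mathcal{A},\mathcal{N})$ is a finite collection of monomials $\binom{x_1}{n_1}\cdots\binom{x_N}{n_N}b_{\underline{n}}$, indexed by $\underline{n}$ in a finite set $\mathcal{N}\subset\mathbb{N}^N$, with coefficients $b_{\underline{n}}$ in a finite set $\mathcal{A}\subset\mathbb{Z}$. Its associated function is $f(\mathcal{P})(x_1,\dots,x_N)=\sum_{\underline{n}\in\mathcal{N}}\binom{x_1}{n_1}\cdots\binom{x_N}{n_N}b_{\underline{n}}$. Its counting number is $\mathrm{count}(\mathcal{P})=\max\{|\underline{n}| : \underline{n}\in\mathcal{N}\}$. For a map $f:\mathbb{Z}^N\to\mathbb{Z}$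 and $a\in\mathbb{Z}^N$, $\Delta_a f(x)=f(x+a)-f(x)$. The functional degree $\mathrm{fdeg}(f)$ is the least number of discrete difference operators needed to make $f$ vanish, minus one: the least $d\in\mathbb{N}$ such that $\Delta_{a_1}\cdots\Delta_{a_{d+1}}f=0$ for all $a_1,\dots,a_{d+1}\in\mathbb{Z}^N$. The trivial case $f=0$ is set aside.
   Formalization: The coefficients b_n (n in the index set) are assumed nonzero: if zero coefficients were allowed, the claim would fail, e.g. for N=1 with b_0=1, b_1=0, where the count is 1 but the functional degree is 0. *)

theory Defs
  imports "HOL-Analysis.Finite_Cartesian_Product" "HOL-Library.Extended_Nat"
begin

text \<open>
  The tuples in \<open>\<nat>\<^sup>N\<close> and \<open>\<int>\<^sup>N\<close> are rendered as \<open>nat ^ 'n\<close> and \<open>int ^ 'n\<close>, where \<open>N\<close> is the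
  cardinality of the finite (and nonempty) index type \<open>'n\<close>.
\<close>

definition weight :: "nat ^ 'n \<Rightarrow> nat" where
  "weight n = (\<Sum>i\<in>UNIV. n $ i)"

text \<open>
  A polyfract \<open>(P, A, I)\<close>: the collection \<open>P\<close> of monomials is given by its coefficients \<open>b n\<close> for
  \<open>n \<in> I\<close>; the values of \<open>b\<close> outside \<open>I\<close> play no role. The coefficients are nonzero, that is,
  \<open>I\<close> indexes monomials that really occur. Otherwise one could raise the counting number
  arbitrarily by adding monomials with coefficient \<open>0\<close>, without changing the function.
\<close>

definition polyfract :: "(nat ^ 'n \<Rightarrow> int) \<Rightarrow> int set \<Rightarrow> (nat ^ 'n) set \<Rightarrow> bool" where
  "polyfract b A I \<longleftrightarrow> finite A \<and> finite I \<and> (\<forall>n\<in>I. b n \<in> A \<and> b n \<noteq> 0)"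

text \<open>
  Integer binomial coefficients: the library's \<open>gchoose\<close> is the same expression, but its
  syntax is restricted to fields of characteristic \<open>0\<close>. The division is exact.
\<close>

definition int_choose :: "int \<Rightarrow> nat \<Rightarrow> int" where
  "int_choose x k = (\<Prod>i=0..<k. x - int i) div fact k"

definition polyfract_fun :: "(nat ^ 'n \<Rightarrow> int) \<Rightarrow> (nat ^ 'n) set \<Rightarrow> int ^ 'n \<Rightarrow> int" where
  "polyfract_fun b I x = (\<Sum>n\<in>I. (\<Prod>i\<in>UNIV. int_choose (x $ i) (n $ i)) * b n)"

text \<open>Only meaningful for finite nonempty \<open>I\<close>.\<close>

definition polyfract_count :: "(nat ^ 'n) set \<Rightarrow> nat" where
  "polyfract_count I = Max (weight ` I)"

definition diff_op :: "int ^ 'n \<Rightarrow> (int ^ 'n \<Rightarrow> int) \<Rightarrow> int ^ 'n \<Rightarrow> int" where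
  "diff_op a f = (\<lambda>x. f (x + a) - f x)"

text \<open>
  The infimum is the least such \<open>d\<close> if there is one, and \<open>\<infinity>\<close> otherwise. The list \<open>as\<close>
  holds \<open>a\<^sub>1, \<dots>, a\<^sub>d\<^sub>+\<^sub>1\<close>. The zero map, which has no meaningful functional degree in \<open>\<nat>\<close>,
  gets the value \<open>0\<close>.
\<close>

definition fdeg :: "(int ^ 'n \<Rightarrow> int) \<Rightarrow> enat" where
  "fdeg f = Inf {enat d | d. \<forall>as. length as = d + 1 \<longrightarrow> foldr diff_op as f = (\<lambda>x. 0)}"

end

theory Submission
  imports Defs "HOL-Library.Multiset" "HOL.Binomial_Plus"
begin

text \<open>
  For the upper bound, the functional degree is at most additive on products by the twisted Leibniz
  rule for \<open>diff_op\<close>, and \<open>k!\<close> times a binomial coefficient in \<open>x\<^sub>i\<close> is a product of \<open>k\<close>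
  linear functions; so a monomial indexed by \<open>n\<close> has degree at most \<open>weight n\<close>.
  For the lower bound, fix an index \<open>m\<close> of maximal weight. By Pascal's rule a difference in a
  unit direction \<open>i\<close> lowers the exponent of \<open>x\<^sub>i\<close> by one. Taking \<open>m\<^sub>i\<close> such differences for
  each \<open>i\<close> turns the monomial indexed by \<open>m\<close> into \<open>1\<close> and kills all others, which leaves
  the nonzero coefficient of \<open>m\<close>.
\<close>

text \<open>Here \<open>k\<close> counts the operators, so degree at most \<open>d\<close> reads
  \<open>diffs_vanish (Suc d)\<close>. The level \<open>0\<close>, meaning \<open>f = 0\<close>, is
  the base case of the inductions.\<close>

definition diffs_vanish :: "nat \<Rightarrow> (int ^ 'n \<Rightarrow> int) \<Rightarrow> bool" where
  "diffs_vanish k f \<longleftrightarrow> (\<forall>as. length as = k \<longrightarrow> foldr diff_op as f = (\<lambda>x. 0))"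

lemma diffs_vanish_0: "diffs_vanish 0 f \<longleftrightarrow> f = (\<lambda>x. 0)"
  by (simp add: diffs_vanish_def)

text \<open>\<open>foldr\<close> applies the last list entry first, so the operator acting directly
  on \<open>f\<close> is split off at the end of the list.\<close>

lemma diffs_vanish_Suc: "diffs_vanish (Suc k) f \<longleftrightarrow> (\<forall>a. diffs_vanish k (diff_op a f))"
proof -
  have "(\<forall>as. length as = Suc k \<longrightarrow> foldr diff_op as f = (\<lambda>x. 0)) \<longleftrightarrow>
      (\<forall>a as. length as = k \<longrightarrow> foldr diff_op (as @ [a]) f = (\<lambda>x. 0))"
    by (metis length_Suc_conv_rev)
  then show ?thesis
    by (simp add: diffs_vanish_def)
qed

lemma diffs_vanish_zero: "diffs_vanish k (\<lambda>x. 0)"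
  by (induction k) (simp_all add: diffs_vanish_0 diffs_vanish_Suc diff_op_def)

lemma diffs_vanish_mono:
  assumes "diffs_vanish k f" "k \<le> l"
  shows "diffs_vanish l f"
  using assms
proof (induction k arbitrary: l f)
  case 0
  then show ?case by (simp add: diffs_vanish_0 diffs_vanish_zero)
next
  case (Suc k)
  then show ?case by (cases l) (auto simp: diffs_vanish_Suc)
qed

section \<open>Differences of sums and products\<close>

lemma diff_op_add: "diff_op a (\<lambda>x. f x + g x) = (\<lambda>x. diff_op a f x + diff_op a g x)"
  by (auto simp: diff_op_def)

lemma diff_op_zero: "diff_op a (\<lambda>x. 0) = (\<lambda>x. 0)"
  by (simp add: diff_op_def)

lemma diff_op_cmult: "diff_op a (\<lambda>x. c * f x) = (\<lambda>x. c * diff_op a f x)"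
  by (auto simp: diff_op_def algebra_simps)

lemma diff_op_mult:
  "diff_op a (\<lambda>x. f x * g x) =
    (\<lambda>x. diff_op a f x * g x + (f x * diff_op a g x + diff_op a f x * diff_op a g x))"
  by (auto simp: diff_op_def algebra_simps)

lemma diffs_vanish_add:
  "diffs_vanish k f \<Longrightarrow> diffs_vanish k g \<Longrightarrow> diffs_vanish k (\<lambda>x. f x + g x)"
  by (induction k arbitrary: f g) (simp_all add: diffs_vanish_0 diffs_vanish_Suc diff_op_add)

lemma diffs_vanish_sum:
  "(\<And>i. i \<in> S \<Longrightarrow> diffs_vanish k (f i)) \<Longrightarrow> diffs_vanish k (\<lambda>x. \<Sum>i\<in>S. f i x)"
  by (induction S rule: infinite_finite_induct) (simp_all add: diffs_vanish_zero diffs_vanish_add)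

text \<open>As \<int> has no zero divisors, a nonzero constant can be cancelled; this later removes
  the factor \<open>fact k\<close>.\<close>

lemma diffs_vanish_cmult_iff:
  "c \<noteq> 0 \<Longrightarrow> diffs_vanish k (\<lambda>x. c * f x) \<longleftrightarrow> diffs_vanish k f"
  by (induction k arbitrary: f)
    (simp_all add: diffs_vanish_0 diffs_vanish_Suc diff_op_cmult fun_eq_iff)

text \<open>Each of the three terms in \<open>diff_op_mult\<close> has a factor that is already a
  difference, so induction on \<open>p + q\<close> applies.\<close>

lemma diffs_vanish_mult:
  assumes "diffs_vanish (Suc p) f" "diffs_vanish (Suc q) g"
  shows "diffs_vanish (Suc (p + q)) (\<lambda>x. f x * g x)"
  using assms
proof (induction "p + q" arbitrary: p q f g rule: less_induct)
  case less
  have "diffs_vanish (p + q) (diff_op a (\<lambda>x. f x * g x))" for a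
  proof -
    have df: "diffs_vanish p (diff_op a f)" and dg: "diffs_vanish q (diff_op a g)"
      using less.prems by (auto simp: diffs_vanish_Suc)
    \<comment> \<open>\<open>h\<close> is general because two terms have this shape, with
      \<open>h = g\<close> and with \<open>h = diff_op a g\<close>. For \<open>p = 0\<close> the
      factor \<open>diff_op a f\<close> is zero.\<close>
    have L: "diffs_vanish (p + q) (\<lambda>x. diff_op a f x * h x)" if "diffs_vanish (Suc q) h" for h
    proof (cases p)
      case 0
      then show ?thesis using df by (simp add: diffs_vanish_0 diffs_vanish_zero)
    next
      case (Suc p')
      then show ?thesis using less.hyps[of p' q "diff_op a f" h] df that by simp
    qed
    have R: "diffs_vanish (p + q) (\<lambda>x. f x * diff_op a g x)"
    proof (cases q)
      case 0
      then show ?thesis using dg by (simp add: diffs_vanish_0 diffs_vanish_zero)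
    next
      case (Suc q')
      then show ?thesis using less.hyps[of p q' f "diff_op a g"] dg less.prems(1) by simp
    qed
    have "diffs_vanish (Suc q) (diff_op a g)"
      using dg diffs_vanish_mono le_SucI by blast
    then show ?thesis
      unfolding diff_op_mult using L R less.prems(2) by (intro diffs_vanish_add)
  qed
  then show ?case by (simp add: diffs_vanish_Suc)
qed

lemma diffs_vanish_const: "diffs_vanish (Suc 0) (\<lambda>x. c)"
  by (simp add: diffs_vanish_Suc diffs_vanish_0 diff_op_def)

lemma diffs_vanish_prod:
  assumes "finite S" "\<And>i. i \<in> S \<Longrightarrow> diffs_vanish (Suc (d i)) (f i)"
  shows "diffs_vanish (Suc (\<Sum>i\<in>S. d i)) (\<lambda>x. \<Prod>i\<in>S. f i x)"
  using assms
  by (induction S rule: finite_induct) (simp_all add: diffs_vanish_const diffs_vanish_mult)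

section \<open>Integer binomial coefficients and the upper bound\<close>

lemma int_choose_0: "int_choose x 0 = 1"
  by (simp add: int_choose_def)

text \<open>The division in \<open>int_choose\<close> is exact. The integer instance of the
  generalized binomial unfolds to the body of \<open>int_choose\<close>, so its library facts carry
  over.\<close>

lemma fact_mult_int_choose: "fact k * int_choose x k = (\<Prod>i=0..<k. x - int i)"
  by (rule gbinomial_int_mult_fact[unfolded gbinomial_prod_rev, folded int_choose_def])

lemma int_choose_diff: "int_choose (x + 1) (Suc k) - int_choose x (Suc k) = int_choose x k"
  using gbinomial_int_Suc_Suc[unfolded gbinomial_prod_rev, folded int_choose_def, of x k] by simp

lemma diffs_vanish_int_choose: "diffs_vanish (Suc k) (\<lambda>x :: int ^ 'n. int_choose (x $ i) k)"
proof -
  have "diffs_vanish (Suc 1) (\<lambda>x :: int ^ 'n. x $ i - int j)" for j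
    by (simp add: diffs_vanish_Suc diffs_vanish_0 diff_op_def)
  then have "diffs_vanish (Suc (\<Sum>j\<in>{0..<k}. 1)) (\<lambda>x :: int ^ 'n. \<Prod>j\<in>{0..<k}. x $ i - int j)"
    by (intro diffs_vanish_prod) auto
  then have "diffs_vanish (Suc k) (\<lambda>x :: int ^ 'n. fact k * int_choose (x $ i) k)"
    by (simp add: fact_mult_int_choose)
  then show ?thesis
    by (simp add: diffs_vanish_cmult_iff)
qed

definition monomial :: "nat ^ 'n \<Rightarrow> int ^ 'n \<Rightarrow> int" where
  "monomial n x = (\<Prod>i\<in>UNIV. int_choose (x $ i) (n $ i))"

lemma polyfract_fun_eq_monomials: "polyfract_fun b I = (\<lambda>x. \<Sum>n\<in>I. b n * monomial n x)"
  by (simp add: fun_eq_iff polyfract_fun_def monomial_def mult.commute)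

lemma diffs_vanish_monomial: "diffs_vanish (Suc (weight n)) (monomial n)"
  unfolding weight_def monomial_def[abs_def]
  by (intro diffs_vanish_prod diffs_vanish_int_choose) simp

lemma diffs_vanish_polyfract_fun:
  assumes "finite I"
  shows "diffs_vanish (Suc (polyfract_count I)) (polyfract_fun b I)"
proof -
  have "diffs_vanish (Suc (polyfract_count I)) (\<lambda>x. b n * monomial n x)" if "n \<in> I" for n
  proof (cases "b n = 0")
    case False
    have "weight n \<le> polyfract_count I"
      using assms that by (simp add: polyfract_count_def)
    then show ?thesis
      using False diffs_vanish_mono[OF diffs_vanish_monomial, of n] by (simp add: diffs_vanish_cmult_iff)
  qed (simp add: diffs_vanish_zero)
  then show ?thesis
    unfolding polyfract_fun_eq_monomials by (intro diffs_vanish_sum)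
qed

section \<open>Differences in unit directions and the lower bound\<close>

lemma diff_op_axis_monomial:
  fixes n :: "nat ^ 'n"
  shows
  "diff_op (axis i 1) (monomial n) =
    (if n $ i = 0 then (\<lambda>x. 0) else monomial (\<chi> j. if j = i then n $ i - 1 else n $ j))"
proof
  fix x :: "int ^ 'n"
  let ?P = "\<lambda>x :: int ^ 'n. \<Prod>j\<in>UNIV - {i}. int_choose (x $ j) (n $ j)"
  have split: "monomial m y = int_choose (y $ i) (m $ i) * (\<Prod>j\<in>UNIV - {i}. int_choose (y $ j) (m $ j))"
    for m and y :: "int ^ 'n"
    unfolding monomial_def by (rule prod.remove) auto
  \<comment> \<open>The shift changes coordinate \<open>i\<close> only, so the other factors come
    out and Pascal's rule acts on the remaining one.\<close>
  have "?P (x + axis i 1) = ?P x"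
    by (intro prod.cong) (auto simp: axis_def)
  then have diff: "diff_op (axis i 1) (monomial n) x =
      (int_choose (x $ i + 1) (n $ i) - int_choose (x $ i) (n $ i)) * ?P x"
    by (simp add: diff_op_def split axis_def algebra_simps)
  show "diff_op (axis i 1) (monomial n) x =
    (if n $ i = 0 then (\<lambda>x. 0) else monomial (\<chi> j. if j = i then n $ i - 1 else n $ j)) x"
  proof (cases "n $ i")
    case 0
    then show ?thesis by (simp add: diff int_choose_0)
  next
    case (Suc k)
    then show ?thesis by (simp add: diff split int_choose_diff)
  qed
qed

lemma foldr_diff_op_axis_monomial:
  "foldr diff_op (map (\<lambda>i. axis i 1) js) (monomial n) =
    (if \<forall>i. count_list js i \<le> n $ i then monomial (\<chi> i. n $ i - count_list js i) else (\<lambda>x. 0))"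
proof (induction js)
  case Nil
  then show ?case by simp
next
  case (Cons j js)
  show ?case
  proof (cases "\<forall>i. count_list js i \<le> n $ i")
    case True
    \<comment> \<open>After the differences in \<open>js\<close>, the exponent of coordinate
      \<open>j\<close> is \<open>n $ j - count_list js j\<close>; one more difference gives zero
      exactly when it is \<open>0\<close>.\<close>
    have 1: "(\<forall>i. count_list (j # js) i \<le> n $ i) \<longleftrightarrow> n $ j - count_list js j \<noteq> 0"
      using True by (auto simp: Suc_le_eq le_neq_implies_less)
    have 2: "(\<chi> i. if i = j then n $ j - count_list js j - 1 else n $ i - count_list js i) =
        (\<chi> i. n $ i - count_list (j # js) i)"
      by (auto simp: vec_eq_iff)
    show ?thesis
      using True unfolding 1 2[symmetric] by (simp add: Cons.IH diff_op_axis_monomial cong: if_cong)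
  next
    case False
    then have "\<not> (\<forall>i. count_list (j # js) i \<le> n $ i)"
      by (metis Suc_leD count_list.simps(2) add.commute plus_1_eq_Suc)
    then show ?thesis
      using False by (simp only: list.map foldr.simps o_apply Cons.IH diff_op_zero if_False)
  qed
qed

lemma foldr_diff_op_sum:
  "foldr diff_op as (\<lambda>x. \<Sum>n\<in>I. b n * g n x) = (\<lambda>x. \<Sum>n\<in>I. b n * foldr diff_op as (g n) x)"
  by (induction as) (simp_all add: diff_op_def sum_subtractf right_diff_distrib)

text \<open>Supplies the directions that reduce the monomial of \<open>m\<close> to
  \<open>1\<close>, using exactly \<open>weight m\<close> differences.\<close>

lemma ex_count_list_eq:
  fixes m :: "nat ^ 'n"
  obtains js where "\<And>i. count_list js i = m $ i" "length js = weight m"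
proof -
  obtain js where js: "mset js = (\<Sum>i\<in>UNIV. replicate_mset (m $ i) i)"
    using ex_mset by blast
  have count: "count_list js i = m $ i" for i
    by (simp add: js count_sum flip: count_mset)
  have "length js = weight m"
    using sum_count_set[of js UNIV] by (simp add: count weight_def)
  with count show thesis by (rule that)
qed

lemma not_diffs_vanish_polyfract_fun:
  fixes b :: "nat ^ 'n \<Rightarrow> int"
  assumes "finite I" "m \<in> I" "b m \<noteq> 0" "\<And>n. n \<in> I \<Longrightarrow> weight n \<le> weight m"
  shows "\<not> diffs_vanish (weight m) (polyfract_fun b I)"
proof
  assume van: "diffs_vanish (weight m) (polyfract_fun b I)"
  obtain js where js: "\<And>i. count_list js i = m $ i" "length js = weight m"
    by (rule ex_count_list_eq[of m]) blast
  let ?D = "foldr diff_op (map (\<lambda>i. axis i 1) js)"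
  have D: "?D (monomial n) = (\<lambda>x. if n = m then 1 else 0)" if "n \<in> I" for n
  proof (cases "\<forall>i. m $ i \<le> n $ i")
    case True
    have "n = m"
    proof (rule ccontr)
      assume "n \<noteq> m"
      then obtain i where "m $ i < n $ i"
        using True by (metis vec_eq_iff le_neq_implies_less)
      \<comment> \<open>An index that dominates \<open>m\<close> and differs from it is heavier,
        against maximality. So every other index in \<open>I\<close> has an exponent below that of
        \<open>m\<close> and its monomial is killed.\<close>
      then have "weight m < weight n"
        unfolding weight_def using True by (intro sum_strict_mono_ex1) auto
      then show False using assms(4)[OF that] by simp
    qed
    moreover have "monomial 0 = (\<lambda>x :: int ^ 'n. 1)"
      by (simp add: fun_eq_iff monomial_def int_choose_0)
    ultimately show ?thesis
      by (simp add: foldr_diff_op_axis_monomial js zero_vec_def)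
  next
    case False
    then show ?thesis by (auto simp: foldr_diff_op_axis_monomial js)
  qed
  have "?D (polyfract_fun b I) = (\<lambda>x. \<Sum>n\<in>I. b n * (if n = m then 1 else 0))"
    unfolding polyfract_fun_eq_monomials foldr_diff_op_sum by (simp add: D)
  also have "\<dots> = (\<lambda>x. b m)"
    using assms(1,2) by (simp add: if_distrib cong: if_cong)
  finally have "?D (polyfract_fun b I) = (\<lambda>x. b m)" .
  moreover have "?D (polyfract_fun b I) = (\<lambda>x. 0)"
    using van js(2) by (simp add: diffs_vanish_def)
  ultimately show False
    using assms(3) by (simp add: fun_eq_iff)
qed

theorem theorem2p1:
  fixes b :: "nat ^ 'n \<Rightarrow> int" and A :: "int set" and I :: "(nat ^ 'n) set"
  assumes "polyfract b A I"
    and "polyfract_fun b I \<noteq> (\<lambda>x. 0)"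
  shows "enat (polyfract_count I) = fdeg (polyfract_fun b I)"
proof -
  have fin: "finite I" and nz: "\<And>n. n \<in> I \<Longrightarrow> b n \<noteq> 0"
    using assms(1) by (auto simp: polyfract_def)
  have "I \<noteq> {}"
    using assms(2) by (auto simp: polyfract_fun_def)
  \<comment> \<open>The sum over an empty \<open>I\<close> would be the zero map; for nonempty
    \<open>I\<close> the maximum is attained.\<close>
  then have "polyfract_count I \<in> weight ` I"
    unfolding polyfract_count_def using fin by (intro Max_in) auto
  then obtain m where m: "m \<in> I" "weight m = polyfract_count I"
    by force
  have "weight n \<le> weight m" if "n \<in> I" for n
    using m(2) fin that by (simp add: polyfract_count_def)
  then have low: "\<not> diffs_vanish (polyfract_count I) (polyfract_fun b I)"
    using not_diffs_vanish_polyfract_fun[of I m b] fin m nz by simp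
  have fdeg: "fdeg (polyfract_fun b I) = Inf {enat d | d. diffs_vanish (Suc d) (polyfract_fun b I)}"
    by (simp add: fdeg_def diffs_vanish_def)
  have "Inf {enat d | d. diffs_vanish (Suc d) (polyfract_fun b I)} = enat (polyfract_count I)"
  proof (rule antisym)
    show "Inf {enat d | d. diffs_vanish (Suc d) (polyfract_fun b I)} \<le> enat (polyfract_count I)"
      using diffs_vanish_polyfract_fun[OF fin] by (intro Inf_lower) blast
    show "enat (polyfract_count I) \<le> Inf {enat d | d. diffs_vanish (Suc d) (polyfract_fun b I)}"
    proof (rule Inf_greatest)
      fix e assume "e \<in> {enat d | d. diffs_vanish (Suc d) (polyfract_fun b I)}"
      then obtain d where d: "e = enat d" "diffs_vanish (Suc d) (polyfract_fun b I)"
        by blast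
      \<comment> \<open>Otherwise monotonicity would make \<open>polyfract_count I\<close>
        differences suffice, against \<open>low\<close>. Hence the least number is one more,
        matching the shift by one in \<open>fdeg\<close>.\<close>
      then have "\<not> Suc d \<le> polyfract_count I"
        using low diffs_vanish_mono by blast
      then show "enat (polyfract_count I) \<le> e"
        using d(1) by simp
    qed
  qed
  then show ?thesis
    using fdeg by simp
qed

end
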